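(* Let $n$ be an integer, let $\Gamma\subset \mathrm{Aff}(\mathbf{R}^n)$ be a countable subgroup, and let $\mathrm{class}:\mathbf{R}^n\to\mathbf{R}^n/\Gamma$ be the projection onto the orbit space. Let $F$ be a smooth map from an open subset $\mathrm{dom}(F)\subset\mathbf{R}^n$ to $\mathbf{R}^n$ such that $\mathrm{class}(F(r))=\mathrm{class}(r)$ for all $r\in\mathrm{dom}(F)$. Then $F$ is everywhere locally equal to the action of some element of $\Gamma$: for every $r_0\in\mathrm{dom}(F)$ there exist an open neighborhood $V\subset \mathrm{dom}(F)$ of $r_0$ and an element $\gamma=(A,b)\in\Gamma$, with $A\in\mathrm{GL}(\mathbf{R}^n)$ and $b\in\mathbf{R}^n$, such that $F(r)=\gamma\cdot r=Ar+b$ for all $r\in V$.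
   Context: $\mathrm{Aff}(\mathbf{R}^n)$ is the group of invertible affine transformations of $\mathbf{R}^n$; an element $\gamma=(A,b)$ acts by $\gamma\cdot r=Ar+b$. The group $\Gamma$ may be infinite (its orbits may be dense). Smooth means $C^\infty$. *)

theory Defs
  imports "HOL-Analysis.Analysis" "HOL-Algebra.Group_Action"
begin

text \<open>
  An invertible affine transformation \<open>r \<mapsto> A r + b\<close> is represented by the pair \<open>(A, b)\<close>.
\<close>

type_synonym 'n affine_map = "(real^'n^'n) \<times> (real^'n)"

definition affine_act :: "'n::finite affine_map \<Rightarrow> real^'n \<Rightarrow> real^'n" where
  "affine_act \<gamma> r = fst \<gamma> *v r + snd \<gamma>"

text \<open>The product is composition of transformations: \<open>A (C r + d) + b = (A C) r + (A d + b)\<close>.\<close>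

definition Aff :: "'n::finite affine_map monoid" where
  "Aff = \<lparr>carrier = {(A, b). invertible A},
          mult = (\<lambda>(A, b) (C, d). (A ** C, A *v d + b)),
          one = (mat 1, 0)\<rparr>"

text \<open>
  The projection to the orbit space: a point of the quotient by \<open>\<Gamma>\<close> is an orbit, as a set.
\<close>

definition orbit_class :: "'n::finite affine_map set \<Rightarrow> real^'n \<Rightarrow> (real^'n) set" where
  "orbit_class \<Gamma> r = orbit (Aff\<lparr>carrier := \<Gamma>\<rparr>) affine_act r"

text \<open>
  \<open>C_on k S f\<close> says that \<open>f\<close> is of class \<open>C\<^sup>k\<close> on \<open>S\<close>; it is meant for open \<open>S\<close>, where it depends
  only on the values of \<open>f\<close> on \<open>S\<close>. In finite dimension, asking that all directional derivatives
  \<open>x \<mapsto> Df(x) v\<close> be of class \<open>C\<^sup>k\<close> is the same as asking that \<open>Df\<close> be so.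
\<close>

primrec C_on ::
  "nat \<Rightarrow> 'a::euclidean_space set \<Rightarrow> ('a \<Rightarrow> 'b::euclidean_space) \<Rightarrow> bool" where
  "C_on 0 S f \<longleftrightarrow> continuous_on S f"
| "C_on (Suc k) S f \<longleftrightarrow>
     (\<forall>x\<in>S. f differentiable (at x)) \<and> (\<forall>v. C_on k S (\<lambda>x. frechet_derivative f (at x) v))"

definition smooth_on ::
  "'a::euclidean_space set \<Rightarrow> ('a \<Rightarrow> 'b::euclidean_space) \<Rightarrow> bool" where
  "smooth_on S f \<longleftrightarrow> (\<forall>k. C_on k S f)"

lemma affine_act_mult: "affine_act (g \<otimes>\<^bsub>Aff\<^esub> h) r = affine_act g (affine_act h r)"
  by (simp add: Aff_def affine_act_def case_prod_unfold matrix_vector_mul_assoc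
      matrix_vector_right_distrib add.assoc)

lemma affine_act_one: "affine_act \<one>\<^bsub>Aff\<^esub> r = r"
  by (simp add: Aff_def affine_act_def)

lemma group_Aff: "group (Aff :: 'n::finite affine_map monoid)"
proof (rule groupI)
  fix x :: "'n affine_map"
  assume x: "x \<in> carrier Aff"
  obtain A b where xe: "x = (A, b)" by fastforce
  with x have "invertible A" by (simp add: Aff_def)
  then obtain A' where A': "A ** A' = mat 1" "A' ** A = mat 1"
    unfolding invertible_def by blast
  then have "invertible A'" unfolding invertible_def by blast
  with A' show "\<exists>y\<in>carrier Aff. y \<otimes>\<^bsub>Aff\<^esub> x = \<one>\<^bsub>Aff\<^esub>"
    by (intro bexI[of _ "(A', - (A' *v b))"]) (simp_all add: Aff_def xe)
qed (auto simp: Aff_def invertible_mult matrix_mul_assoc matrix_vector_mul_assoc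
      matrix_vector_right_distrib add.assoc, auto simp: invertible_def)

end

theory Submission
  imports Defs
begin

text \<open>
  The sets \<open>{r. F r = \<gamma> \<cdot> r}\<close>, for \<open>\<gamma> \<in> \<Gamma>\<close>, are relatively closed in the domain of \<open>F\<close>, and they
  cover it because \<open>F r\<close> and \<open>r\<close> lie on the same orbit. There are countably many of them, so Baire's
  theorem, applied to each nonempty open subset \<open>W\<close> of the domain, shows that \<open>F\<close> agrees with a single
  \<open>\<gamma>\<close> on some nonempty open subset of \<open>W\<close>
  (\<open>countable_closed_cover_contains_open\<close>). Hence \<open>F\<close> is locally affine on a dense open set.

  A priori different group elements could occur on different pieces of this dense set, and the
  pieces could accumulate at \<open>r\<^sub>0\<close>. Smoothness excludes this: the second derivative of \<open>F\<close> vanishes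
  on the dense set, hence everywhere by continuity, so \<open>F\<close> is affine on a ball in its domain around
  \<open>r\<^sub>0\<close> (\<open>C2_densely_affine_imp_affine\<close>). On some nonempty open part of that ball it equals
  some \<open>\<gamma>\<close>, and an affine map is determined by its values on a nonempty open set
  (\<open>affine_eq_if_eq_on_open\<close>); so \<open>F\<close> equals \<open>\<gamma>\<close> on the ball.
\<close>

text \<open>
  An open subset of a locally compact space is locally compact, so Baire's theorem holds in \<open>W\<close>
  itself: if every \<open>C i\<close> had empty interior in \<open>W\<close>, so would their union, which is all of \<open>W\<close>.
\<close>

lemma countable_closed_cover_contains_open:
  fixes W :: "'a::heine_borel set"
  assumes "open W" and "W \<noteq> {}" and "countable I"
    and closed: "\<And>i. i \<in> I \<Longrightarrow> closedin (top_of_set W) (C i)"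
    and cover: "W \<subseteq> (\<Union>i\<in>I. C i)"
  obtains i U where "i \<in> I" "open U" "U \<noteq> {}" "U \<subseteq> C i" "U \<subseteq> W"
proof -
  let ?X = "top_of_set W"
  have reg: "regular_space ?X"
    by (simp add: metrizable_imp_regular_space metrizable_space_euclidean metrizable_space_subtopology)
  have "Hausdorff_space (euclidean :: 'a topology)"
    by simp
  then have "locally_compact_space ?X"
    using locally_compact_space_open_subset[OF _ locally_compact_space_euclidean, of W] \<open>open W\<close>
    by (simp add: open_openin[symmetric])
  then have baire: "?X interior_of \<Union>(C ` I) = {}" if "\<And>i. i \<in> I \<Longrightarrow> ?X interior_of C i = {}"
    using reg that closed \<open>countable I\<close> by (intro Baire_category_alt) auto
  have "(\<Union>i\<in>I. C i) = W"
    using cover closed closedin_imp_subset by blast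
  then have "?X interior_of \<Union>(C ` I) = W"
    using interior_of_topspace[of ?X] by simp
  with baire \<open>W \<noteq> {}\<close> obtain i where "i \<in> I" and ne: "?X interior_of C i \<noteq> {}"
    by auto
  moreover have "open (?X interior_of C i)"
    using openin_interior_of[of ?X "C i"] \<open>open W\<close> by (metis openin_open_eq)
  moreover have "?X interior_of C i \<subseteq> W"
    using interior_of_subset_topspace[of ?X "C i"] by simp
  ultimately show thesis
    using that interior_of_subset[of ?X "C i"] by blast
qed

lemma C_on_subset: "C_on k S f \<Longrightarrow> T \<subseteq> S \<Longrightarrow> C_on k T f"
  by (induction k arbitrary: f) (auto intro: continuous_on_subset)

lemma affine_has_derivative:
  fixes L :: "'a::euclidean_space \<Rightarrow> 'b::real_normed_vector"
  assumes "linear L"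
  shows "((\<lambda>x. L x + c) has_derivative L) (at x)"
  using linear_imp_has_derivative[OF assms] by (auto intro!: derivative_eq_intros)

text \<open>
  The derivative at a point of \<open>U\<close> recovers the linear part, and the value there the constant.
\<close>

lemma affine_eq_if_eq_on_open:
  fixes L M :: "'a::euclidean_space \<Rightarrow> 'b::real_normed_vector"
  assumes "linear L" "linear M" "open U" "U \<noteq> {}"
    and eq: "\<And>x. x \<in> U \<Longrightarrow> L x + c = M x + d"
  shows "L x + c = M x + d"
proof -
  obtain u where "u \<in> U" using \<open>U \<noteq> {}\<close> by blast
  have "((\<lambda>x. M x + d) has_derivative L) (at u)"
    using affine_has_derivative[OF \<open>linear L\<close>] \<open>open U\<close> \<open>u \<in> U\<close> eq
    by (rule has_derivative_transform_within_open)
  then have "L = M"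
    using affine_has_derivative[OF \<open>linear M\<close>] has_derivative_unique by blast
  with eq[OF \<open>u \<in> U\<close>] show ?thesis by simp
qed

text \<open>
  Where \<open>f\<close> is affine, its derivative is locally constant, so its second derivative is zero; a point
  with nonzero second derivative would have a whole open neighbourhood \<open>W\<close> of such points, which
  density forbids. With zero second derivative, the derivative is a constant linear map \<open>D\<close> on the
  connected set \<open>S\<close>, and then \<open>f - D\<close> is constant too. Mere continuity of
  \<open>f\<close> would not do: the Cantor function is continuous and locally constant on a dense open set.
\<close>

lemma C2_densely_affine_imp_affine:
  fixes f :: "'a::euclidean_space \<Rightarrow> 'b::euclidean_space"
  assumes "open S" "connected S" and C2: "C_on 2 S f"
    and dense: "\<And>W. open W \<Longrightarrow> W \<subseteq> S \<Longrightarrow> W \<noteq> {} \<Longrightarrow>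
      \<exists>U L c. open U \<and> U \<noteq> {} \<and> U \<subseteq> W \<and> linear L \<and> (\<forall>x\<in>U. f x = L x + c)"
  obtains L c where "linear L" "\<And>x. x \<in> S \<Longrightarrow> f x = L x + c"
proof (cases "S = {}")
  case True
  then show thesis using that[of "\<lambda>_. 0" 0] by (simp add: linear_zero)
next
  case False
  define D where "D x = frechet_derivative f (at x)" for x
  define D2 where "D2 v x = frechet_derivative (\<lambda>y. D y v) (at x)" for v x
  have f': "(f has_derivative D x) (at x)" if "x \<in> S" for x
    using C2 that by (simp add: numeral_2_eq_2 D_def frechet_derivative_works[symmetric])
  have D': "((\<lambda>y. D y v) has_derivative D2 v x) (at x)" if "x \<in> S" for x v
    using C2 that by (simp add: numeral_2_eq_2 D_def D2_def frechet_derivative_works[symmetric])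
  have D2_cont: "continuous_on S (\<lambda>x. D2 v x w)" for v w
    using C2 by (simp add: numeral_2_eq_2 D_def D2_def)
  have D2_zero: "D2 v x w = 0" if "x \<in> S" for v w x
  proof (rule ccontr)
    assume "D2 v x w \<noteq> 0"
    define W where "W = {y \<in> S. D2 v y w \<noteq> 0}"
    have "open (- {0::'b})"
      by (intro open_Compl closed_singleton)
    then have "open (S \<inter> (\<lambda>y. D2 v y w) -` (- {0}))"
      by (rule continuous_open_preimage[OF D2_cont \<open>open S\<close>])
    moreover have "W = S \<inter> (\<lambda>y. D2 v y w) -` (- {0})"
      by (auto simp: W_def)
    ultimately have "open W"
      by simp
    moreover have "W \<subseteq> S" "W \<noteq> {}"
      using \<open>x \<in> S\<close> \<open>D2 v x w \<noteq> 0\<close> by (auto simp: W_def)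
    ultimately obtain U L c where U: "open U" "U \<noteq> {}" "U \<subseteq> W" and "linear L"
      and eq: "\<forall>x\<in>U. f x = L x + c"
      using dense[of W] by auto
    have D_U: "D y = L" if "y \<in> U" for y
    proof -
      have "(f has_derivative L) (at y)"
        using affine_has_derivative[OF \<open>linear L\<close>] \<open>open U\<close> that
        by (rule has_derivative_transform_within_open) (simp add: eq)
      then show ?thesis
        using f' has_derivative_unique that U \<open>W \<subseteq> S\<close> by blast
    qed
    obtain u where "u \<in> U" using U by blast
    have "((\<lambda>y. D y v) has_derivative (\<lambda>_. 0)) (at u)"
      using has_derivative_const \<open>open U\<close> \<open>u \<in> U\<close>
      by (rule has_derivative_transform_within_open) (simp add: D_U)
    then have "D2 v u = (\<lambda>_. 0)"
      using D' has_derivative_unique \<open>u \<in> U\<close> U \<open>W \<subseteq> S\<close> by blast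
    then show False
      using \<open>u \<in> U\<close> U by (auto simp: W_def)
  qed
  obtain a where "a \<in> S" using False by blast
  have "D2 v x = (\<lambda>_. 0)" if "x \<in> S" for x v
    using D2_zero[OF that] by (simp add: fun_eq_iff)
  then have "((\<lambda>y. D y v) has_derivative (\<lambda>_. 0)) (at x)" if "x \<in> S" for x v
    using D'[OF that, of v] that by simp
  then have D_const: "D x v = D a v" if "x \<in> S" for x v
    using has_derivative_zero_unique_connected[OF \<open>open S\<close> \<open>connected S\<close>, of "\<lambda>y. D y v"]
      \<open>a \<in> S\<close> that by blast
  have lin: "linear (D a)"
    using f'[OF \<open>a \<in> S\<close>] by (rule has_derivative_linear)
  have "((\<lambda>y. f y - D a y) has_derivative (\<lambda>_. 0)) (at x)" if "x \<in> S" for x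
    using has_derivative_diff[OF f'[OF that] linear_imp_has_derivative[OF lin]] D_const[OF that]
    by simp
  then have "f x - D a x = f a - D a a" if "x \<in> S" for x
    using has_derivative_zero_unique_connected[OF \<open>open S\<close> \<open>connected S\<close>, of "\<lambda>y. f y - D a y"]
      \<open>a \<in> S\<close> that by blast
  then show thesis
    using that[OF lin, of "f a - D a a"] by (simp add: algebra_simps)
qed

lemma orbit_class_eq_imp_act:
  assumes "subgroup \<Gamma> Aff" and "orbit_class \<Gamma> s = orbit_class \<Gamma> r"
  obtains \<gamma> where "\<gamma> \<in> \<Gamma>" "s = affine_act \<gamma> r"
proof -
  have orbit: "orbit_class \<Gamma> x = {affine_act \<gamma> x | \<gamma>. \<gamma> \<in> \<Gamma>}" for x
    by (simp add: orbit_class_def orbit_def)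
  have "affine_act \<one>\<^bsub>Aff\<^esub> s \<in> orbit_class \<Gamma> s"
    using subgroup.one_closed[OF assms(1)] unfolding orbit by blast
  then have "s \<in> orbit_class \<Gamma> r"
    unfolding affine_act_one assms(2) .
  then show thesis
    using that unfolding orbit by blast
qed

theorem mainTheorem1:
  fixes \<Gamma> :: "((real^'n^'n) \<times> (real^'n)) set"
    and domF :: "(real^'n) set"
    and F :: "real^'n \<Rightarrow> real^'n"
  assumes "subgroup \<Gamma> Aff"
    and "countable \<Gamma>"
    and "open domF"
    and "smooth_on domF F"
    and "\<forall>r\<in>domF. orbit_class \<Gamma> (F r) = orbit_class \<Gamma> r"
  shows "\<forall>r0\<in>domF. \<exists>V A b. open V \<and> r0 \<in> V \<and> V \<subseteq> domF \<and>
           (A, b) \<in> \<Gamma> \<and> invertible A \<and>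
           (\<forall>r\<in>V. F r = affine_act (A, b) r \<and> affine_act (A, b) r = A *v r + b)"
proof
  fix r0 assume "r0 \<in> domF"
  have C2: "C_on 2 domF F"
    using assms(4) by (simp add: smooth_on_def)
  have cont: "continuous_on domF F"
    using assms(4) by (metis C_on.simps(1) smooth_on_def)
  have locally: "\<exists>U A b. open U \<and> U \<noteq> {} \<and> U \<subseteq> W \<and> (A, b) \<in> \<Gamma> \<and> (\<forall>r\<in>U. F r = A *v r + b)"
    if "open W" "W \<subseteq> domF" "W \<noteq> {}" for W
  proof -
    \<comment> \<open>The equation is put as membership of a difference in \<open>{0}\<close> so that \<open>C \<gamma>\<close> is literally the
      preimage of a closed set.\<close>
    define C where "C \<gamma> = {r \<in> W. F r - affine_act \<gamma> r \<in> {0}}" for \<gamma>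
    have "closedin (top_of_set W) (C \<gamma>)" for \<gamma>
    proof -
      have "continuous_on W (\<lambda>r. F r - affine_act \<gamma> r)"
        unfolding affine_act_def using continuous_on_subset[OF cont \<open>W \<subseteq> domF\<close>]
        by (intro continuous_intros matrix_vector_mult_linear_continuous_on) auto
      then show ?thesis
        unfolding C_def
        using continuous_closedin_preimage[of W "\<lambda>r. F r - affine_act \<gamma> r" "{0}"]
        by (simp add: vimage_def Int_def)
    qed
    moreover have "W \<subseteq> (\<Union>\<gamma>\<in>\<Gamma>. C \<gamma>)"
    proof
      fix r assume "r \<in> W"
      then have "orbit_class \<Gamma> (F r) = orbit_class \<Gamma> r"
        using assms(5) \<open>W \<subseteq> domF\<close> by blast
      then obtain \<gamma> where "\<gamma> \<in> \<Gamma>" "F r = affine_act \<gamma> r"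
        using orbit_class_eq_imp_act[OF assms(1)] by blast
      then show "r \<in> (\<Union>\<gamma>\<in>\<Gamma>. C \<gamma>)"
        using \<open>r \<in> W\<close> by (auto simp: C_def)
    qed
    ultimately obtain \<gamma> U where "\<gamma> \<in> \<Gamma>" "open U" "U \<noteq> {}" "U \<subseteq> C \<gamma>" "U \<subseteq> W"
      using countable_closed_cover_contains_open[OF \<open>open W\<close> \<open>W \<noteq> {}\<close> assms(2), of C] by blast
    then show ?thesis
      by (intro exI[of _ U] exI[of _ "fst \<gamma>"] exI[of _ "snd \<gamma>"]) (auto simp: C_def affine_act_def)
  qed
  obtain e where "e > 0" and ball: "ball r0 e \<subseteq> domF"
    using assms(3) \<open>r0 \<in> domF\<close> open_contains_ball by blast
  have "\<exists>U L c. open U \<and> U \<noteq> {} \<and> U \<subseteq> W \<and> linear L \<and> (\<forall>x\<in>U. F x = L x + c)"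
    if "open W" "W \<subseteq> ball r0 e" "W \<noteq> {}" for W
    using locally[OF that(1) _ that(3)] that(2) ball matrix_vector_mul_linear
    by (metis subset_trans)
  then obtain L c where L: "linear L" and F_ball: "\<And>x. x \<in> ball r0 e \<Longrightarrow> F x = L x + c"
    using C2_densely_affine_imp_affine[OF open_ball connected_ball C_on_subset[OF C2 ball]] by blast
  obtain U A b where U: "open U" "U \<noteq> {}" "U \<subseteq> ball r0 e" and Ab: "(A, b) \<in> \<Gamma>"
    and F_U: "\<forall>r\<in>U. F r = A *v r + b"
    using locally[OF open_ball ball] \<open>e > 0\<close> by auto
  have "L r + c = A *v r + b" for r
    using L matrix_vector_mul_linear U(1,2)
  proof (rule affine_eq_if_eq_on_open)
    show "L x + c = A *v x + b" if "x \<in> U" for x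
      using F_U F_ball U(3) that by (metis subsetD)
  qed
  moreover have "invertible A"
    using subgroup.subset[OF assms(1)] Ab by (auto simp: Aff_def)
  ultimately show "\<exists>V A b. open V \<and> r0 \<in> V \<and> V \<subseteq> domF \<and> (A, b) \<in> \<Gamma> \<and> invertible A \<and>
           (\<forall>r\<in>V. F r = affine_act (A, b) r \<and> affine_act (A, b) r = A *v r + b)"
    using \<open>e > 0\<close> ball Ab F_ball
    by (intro exI[of _ "ball r0 e"] exI[of _ A] exI[of _ b]) (auto simp: affine_act_def)
qed

end
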